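(* Let $X$ and $Y$ be geodesic metric spaces with basepoints, and let $\phi : X \to Y$ be a map. Then $\phi$ is an $O(\log)$-bilipschitz equivalence if and only if $\phi$ is a coarse equivalence from $(X,\mathcal{E}_X^{O(\log)})$ to $(Y,\mathcal{E}_Y^{O(\log)})$.
   Context: For a pointed metric space $(X,o_X)$ write $|x| = d_X(o_X,x)$; $\vee$ denotes maximum. Here $\log$ stands for the function $u:[0,+\infty)\to(0,+\infty)$ with $u(r)=\log r$ for $r\geqslant 2$ and $u(r)=1$ otherwise. $O(u)$-bilipschitz equivalence: a map $\phi : X \to Y$ (not assumed continuous) between pointed metric spaces such that there are $\kappa\geqslant 1$, $c\geqslant 0$ with, for all $x,x'\in X$, $y\in Y$, $$-c\,u(|x|\vee|x'|)+\tfrac1\kappa d_X(x,x')\leqslant d_Y(\phi(x),\phi(x'))\leqslant \kappa d_X(x,x')+c\,u(|x|\vee|x'|),\qquad d_Y(y,\phi(X))\leqslant c\,u(|y|).$$ Coarse structure: a coarse structure on a set $X$ is a collection of subsets of $X\times X$ (entourages) containing the diagonal and stable under composition, inverse, subsets and finite unions. The coarse structure $\mathcal{E}_X^{O(u)}$ consists of all $E\subseteq X\times X$ such that $$\limsup_{r\to+\infty}\ \sup_{(x,x')\in E,\ \max(|x|,|x'|)\geqslant r}\frac{d_X(x,x')}{u(|x|)}<+\infty .$$ Coarse map: $\phi:(X,\mathcal E_X)\to(Y,\mathcal E_Y)$ is coarse if (a) for all $B\subseteq Y$, $B\times B\in\mathcal E_Y$ implies $\phi^{-1}(B)\times\phi^{-1}(B)\in\mathcal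 E_X$, and (b) for all $E\in\mathcal E_X$, $(\phi\times\phi)(E)\in\mathcal E_Y$. It is a coarse equivalence if moreover there is a coarse map $\psi:Y\to X$ such that the graphs of $\psi\circ\phi$ and $\phi\circ\psi$ are contained in entourages of $\mathcal E_X$ and $\mathcal E_Y$ respectively. *)

theory Defs
  imports "HOL-Analysis.Analysis"
begin

section \<open>Geodesic spaces\<close>

definition geodesic_space :: "'a::metric_space itself \<Rightarrow> bool" where
  "geodesic_space _ \<longleftrightarrow>
     (\<forall>x y :: 'a. \<exists>\<gamma> :: real \<Rightarrow> 'a.
        \<gamma> 0 = x \<and> \<gamma> (dist x y) = y \<and>
        (\<forall>s\<in>{0..dist x y}. \<forall>t\<in>{0..dist x y}. dist (\<gamma> s) (\<gamma> t) = \<bar>s - t\<bar>))"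


section \<open>\<open>O(u)\<close>-bilipschitz equivalences\<close>

text \<open>The convention for ``log'': it agrees with the natural logarithm on \<open>[2,\<infinity>)\<close>
  and is constantly 1 on \<open>[0,2)\<close>; it jumps down at 2 and hence is not monotone.\<close>

definition ulog :: "real \<Rightarrow> real" where
  "ulog r = (if r \<ge> 2 then ln r else 1)"

text \<open>A pointed space is a type together with a basepoint \<open>p\<close>, and \<open>|x|\<close> is
  \<open>dist p x\<close>. The map is not required to preserve basepoints.\<close>

definition O_bilipschitz_equivalence ::
    "(real \<Rightarrow> real) \<Rightarrow> 'a::metric_space \<Rightarrow> 'b::metric_space \<Rightarrow> ('a \<Rightarrow> 'b) \<Rightarrow> bool" where
  "O_bilipschitz_equivalence u p q \<phi> \<longleftrightarrow>
     (\<exists>\<kappa> c :: real. \<kappa> \<ge> 1 \<and> c \<ge> 0 \<and>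
        (\<forall>x x'. - c * u (max (dist p x) (dist p x')) + (1 / \<kappa>) * dist x x'
                    \<le> dist (\<phi> x) (\<phi> x') \<and>
                dist (\<phi> x) (\<phi> x')
                    \<le> \<kappa> * dist x x' + c * u (max (dist p x) (dist p x'))) \<and>
        (\<forall>y. infdist y (range \<phi>) \<le> c * u (dist q y)))"


section \<open>Coarse structures and coarse equivalences\<close>

definition coarse_structure :: "('a \<times> 'a) set set \<Rightarrow> bool" where
  "coarse_structure \<E> \<longleftrightarrow>
     Id \<in> \<E> \<and>
     (\<forall>E\<in>\<E>. \<forall>F\<in>\<E>. E O F \<in> \<E>) \<and>
     (\<forall>E\<in>\<E>. E\<inverse> \<in> \<E>) \<and>
     (\<forall>E\<in>\<E>. \<forall>F. F \<subseteq> E \<longrightarrow> F \<in> \<E>) \<and>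
     (\<forall>E\<in>\<E>. \<forall>F\<in>\<E>. E \<union> F \<in> \<E>)"

definition coarse_map ::
    "('a \<times> 'a) set set \<Rightarrow> ('b \<times> 'b) set set \<Rightarrow> ('a \<Rightarrow> 'b) \<Rightarrow> bool" where
  "coarse_map \<E> \<F> \<phi> \<longleftrightarrow>
     (\<forall>B. B \<times> B \<in> \<F> \<longrightarrow> (\<phi> -` B) \<times> (\<phi> -` B) \<in> \<E>) \<and>
     (\<forall>E\<in>\<E>. map_prod \<phi> \<phi> ` E \<in> \<F>)"

definition coarse_equivalence ::
    "('a \<times> 'a) set set \<Rightarrow> ('b \<times> 'b) set set \<Rightarrow> ('a \<Rightarrow> 'b) \<Rightarrow> bool" where
  "coarse_equivalence \<E> \<F> \<phi> \<longleftrightarrow>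
     coarse_map \<E> \<F> \<phi> \<and>
     (\<exists>\<psi>. coarse_map \<F> \<E> \<psi> \<and>
          (\<exists>E\<in>\<E>. range (\<lambda>x. (x, (\<psi> \<circ> \<phi>) x)) \<subseteq> E) \<and>
          (\<exists>F\<in>\<F>. range (\<lambda>y. (y, (\<phi> \<circ> \<psi>) y)) \<subseteq> F))"

text \<open>The supremum is taken in \<^typ>\<open>ereal\<close>: it is \<open>-\<infinity>\<close> if no pair of \<open>E\<close> qualifies
  (so that every bounded \<open>E\<close> is an entourage) and \<open>\<infinity>\<close> if the quotients are unbounded.\<close>

definition O_entourages :: "(real \<Rightarrow> real) \<Rightarrow> 'a::metric_space \<Rightarrow> ('a \<times> 'a) set set" where
  "O_entourages u p =
     {E. Limsup at_top (\<lambda>r::real.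
           SUP (x, x') \<in> {(x, x'). (x, x') \<in> E \<and> max (dist p x) (dist p x') \<ge> r}.
             ereal (dist x x' / u (dist p x))) < \<infinity>}"


subsection \<open>The entourages for \<open>u = log\<close> form a coarse structure\<close>

lemma ulog_ge: "ulog r \<ge> ln 2"
proof -
  have "ln 2 \<le> (1::real)"
    using ln_le_minus_one[of "2::real"] by simp
  then show ?thesis
    by (auto simp: ulog_def)
qed

lemma ulog_pos: "ulog r > 0"
  using ulog_ge[of r] ln_gt_zero[of "2::real"] by linarith

lemma O_entourages_ulog_iff:
  "E \<in> O_entourages ulog p \<longleftrightarrow>
     (\<exists>C\<ge>0. \<forall>(x, x')\<in>E. dist x x' \<le> C * ulog (dist p x))"
proof
  assume "E \<in> O_entourages ulog p"
  then have "Limsup at_top (\<lambda>r::real.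
           SUP (x, x') \<in> {(x, x'). (x, x') \<in> E \<and> max (dist p x) (dist p x') \<ge> r}.
             ereal (dist x x' / ulog (dist p x))) < \<infinity>"
    by (simp add: O_entourages_def)
  then obtain M :: ereal where M: "M < \<infinity>" "Limsup at_top (\<lambda>r::real.
           SUP (x, x') \<in> {(x, x'). (x, x') \<in> E \<and> max (dist p x) (dist p x') \<ge> r}.
             ereal (dist x x' / ulog (dist p x))) < M"
    using dense by blast
  then have "\<forall>\<^sub>F r in at_top.
           (SUP (x, x') \<in> {(x, x'). (x, x') \<in> E \<and> max (dist p x) (dist p x') \<ge> r}.
             ereal (dist x x' / ulog (dist p x))) < M"
    by (intro Limsup_lessD)
  then obtain r :: real where r:
           "(SUP (x, x') \<in> {(x, x'). (x, x') \<in> E \<and> max (dist p x) (dist p x') \<ge> r}.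
             ereal (dist x x' / ulog (dist p x))) < M"
    by (auto simp: eventually_at_top_linorder)
  obtain m where m: "M \<le> ereal m"
    using M(1) by (cases M) auto
  define C where "C = max 0 m + 2 * \<bar>r\<bar> / ln 2"
  have "0 \<le> 2 * \<bar>r\<bar> / ln 2" by simp
  then have mC: "m \<le> C" and C0: "0 \<le> C"
    unfolding C_def by linarith+
  have "dist x x' \<le> C * ulog (dist p x)" if "(x, x') \<in> E" for x x'
  proof (cases "max (dist p x) (dist p x') \<ge> r")
    case True
    then have "ereal (dist x x' / ulog (dist p x)) \<le>
           (SUP (x, x') \<in> {(x, x'). (x, x') \<in> E \<and> max (dist p x) (dist p x') \<ge> r}.
             ereal (dist x x' / ulog (dist p x)))"
      using that by (intro SUP_upper2[of "(x, x')"]) auto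
    with r m have "ereal (dist x x' / ulog (dist p x)) \<le> ereal m"
      by (meson order.trans less_imp_le)
    then have "dist x x' \<le> m * ulog (dist p x)"
      using ulog_pos[of "dist p x"] by (simp add: pos_divide_le_eq)
    also have "\<dots> \<le> C * ulog (dist p x)"
      using ulog_pos[of "dist p x"] mC by (intro mult_right_mono) auto
    finally show ?thesis .
  next
    case False
    then have "dist x x' \<le> 2 * \<bar>r\<bar>"
      using dist_triangle3[of x x' p] by (auto simp: max_def split: if_splits)
    also have "\<dots> = 2 * \<bar>r\<bar> / ln 2 * ln 2"
      by simp
    also have "\<dots> \<le> C * ulog (dist p x)"
      using ulog_ge[of "dist p x"] by (intro mult_mono) (auto simp: C_def)
    finally show ?thesis .
  qed
  then show "\<exists>C\<ge>0. \<forall>(x, x')\<in>E. dist x x' \<le> C * ulog (dist p x)"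
    by (intro exI[of _ C]) (auto simp: C_def)
next
  assume "\<exists>C\<ge>0. \<forall>(x, x')\<in>E. dist x x' \<le> C * ulog (dist p x)"
  then obtain C where C: "\<And>x x'. (x, x') \<in> E \<Longrightarrow> dist x x' \<le> C * ulog (dist p x)"
    by blast
  have "(SUP (x, x') \<in> {(x, x'). (x, x') \<in> E \<and> max (dist p x) (dist p x') \<ge> r}.
             ereal (dist x x' / ulog (dist p x))) \<le> ereal C" for r
    using C ulog_pos by (intro SUP_least) (auto simp: pos_divide_le_eq)
  then have "Limsup at_top (\<lambda>r::real.
           SUP (x, x') \<in> {(x, x'). (x, x') \<in> E \<and> max (dist p x) (dist p x') \<ge> r}.
             ereal (dist x x' / ulog (dist p x))) \<le> ereal C"
    by (intro Limsup_bounded always_eventually) blast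
  then show "E \<in> O_entourages ulog p"
    unfolding O_entourages_def using le_less_trans by fastforce
qed

lemma ulog_linear_bound:
  assumes "a \<ge> 0" "b \<ge> 0"
  obtains K where "K \<ge> 0" "\<And>r s. 0 \<le> r \<Longrightarrow> 0 \<le> s \<Longrightarrow> s \<le> a * r + b \<Longrightarrow> ulog s \<le> K * ulog r"
proof -
  define A where "A = a + b + 1"
  define K where "K = 1 / ln 2 + (1 + ln A / ln 2) + ln (2 * A) / ln 2"
  have l2: "ln 2 > (0::real)" by simp
  have A: "A \<ge> 1" using assms by (simp add: A_def)
  have K0: "K \<ge> 0" using A by (simp add: K_def)
  have K1: "1 \<le> K * ln 2"
    using A l2 by (simp add: K_def field_simps)
  have "ulog s \<le> K * ulog r" if rs: "0 \<le> r" "0 \<le> s" "s \<le> a * r + b" for r s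
  proof (cases "s \<ge> 2")
    case False
    have "K * ln 2 \<le> K * ulog r"
      using K0 ulog_ge by (intro mult_left_mono)
    then show ?thesis
      using K1 False by (simp add: ulog_def)
  next
    case s2: True
    show ?thesis
    proof (cases "r \<ge> 2")
      case True
      have "b * 1 \<le> b * r" using assms True by (intro mult_left_mono) auto
      then have "s \<le> A * r"
        using rs True by (simp add: A_def algebra_simps)
      then have "ln s \<le> ln (A * r)"
        using s2 by simp
      also have "\<dots> = ln A + ln r"
        using A True by (simp add: ln_mult)
      also have "ln A * ln 2 \<le> ln A * ln r"
        using A True by (intro mult_left_mono) auto
      then have "ln A + ln r \<le> (1 + ln A / ln 2) * ln r"
        using l2 by (simp add: field_simps)
      also have "\<dots> \<le> K * ln r"
      proof (rule mult_right_mono)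
        have "0 \<le> ln A / ln 2" "0 \<le> ln (2 * A) / ln 2" "0 \<le> 1 / ln (2::real)"
          using A by auto
        then show "1 + ln A / ln 2 \<le> K" unfolding K_def by linarith
      qed (use True in auto)
      finally show ?thesis
        using True s2 by (simp add: ulog_def)
    next
      case False
      have "a * r \<le> a * 2" using assms False by (intro mult_left_mono) auto
      then have "s \<le> 2 * A"
        using rs assms by (simp add: A_def)
      then have "ln s \<le> ln (2 * A)" using s2 by simp
      also have "\<dots> \<le> K"
      proof -
        have "ln 2 \<le> (1::real)" using ln_le_minus_one[of "2::real"] by simp
        then have "ln (2 * A) * ln 2 \<le> ln (2 * A) * 1"
          using A by (intro mult_left_mono) auto
        then have "ln (2 * A) \<le> ln (2 * A) / ln 2"
          using l2 by (simp add: field_simps)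
        moreover have "0 \<le> ln A / ln 2" "0 \<le> 1 / ln (2::real)"
          using A by auto
        ultimately show ?thesis unfolding K_def by linarith
      qed
      finally show ?thesis
        using False s2 by (simp add: ulog_def)
    qed
  qed
  with K0 show ?thesis using that by blast
qed

lemma ulog_le_sqrt: "r \<ge> 0 \<Longrightarrow> ulog r \<le> 1 + 2 * sqrt r"
proof (cases "r \<ge> 2")
  case True
  then have "ln r = 2 * ln (sqrt r)" by (simp add: ln_sqrt)
  also have "\<dots> \<le> 2 * (sqrt r - 1)" using True by (intro mult_left_mono ln_le_minus_one) auto
  finally show ?thesis using True by (simp add: ulog_def)
qed (auto simp: ulog_def)

lemma ulog_near:
  assumes "C \<ge> 0"
  obtains K where "K \<ge> 0"
    "\<And>(p::'a::metric_space) x x'. dist x x' \<le> C * ulog (dist p x) \<Longrightarrow>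
        ulog (dist p x) \<le> K * ulog (dist p x') \<and> ulog (dist p x') \<le> K * ulog (dist p x)"
proof -
  define b where "b = 2 * C + 4 * C\<^sup>2"
  have b: "b \<ge> 0" using assms by (simp add: b_def)
  obtain K where K: "K \<ge> 0"
    "\<And>r s. 0 \<le> r \<Longrightarrow> 0 \<le> s \<Longrightarrow> s \<le> 2 * r + b \<Longrightarrow> ulog s \<le> K * ulog r"
    using ulog_linear_bound[of 2 b] b by auto
  have "ulog (dist p x) \<le> K * ulog (dist p x') \<and> ulog (dist p x') \<le> K * ulog (dist p x)"
    if *: "dist x x' \<le> C * ulog (dist p x)" for p x x' :: 'a
  proof -
    define t where "t = sqrt (dist p x)"
    have t: "dist p x = t\<^sup>2" by (simp add: t_def)
    have "C * ulog (dist p x) \<le> C * (1 + 2 * t)"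
      using assms ulog_le_sqrt[of "dist p x"] by (intro mult_left_mono) (auto simp: t_def)
    also have "\<dots> \<le> t\<^sup>2 / 2 + b / 2"
      using zero_le_power2[of "t - 2 * C"]
      by (simp add: b_def power2_eq_square field_simps)
    finally have d: "2 * dist x x' \<le> dist p x + b"
      using * t by simp
    have "dist p x \<le> 2 * dist p x' + b"
      using d dist_triangle[of p x x'] by (simp add: dist_commute)
    moreover have "dist p x' \<le> 2 * dist p x + b"
      using d dist_triangle[of p x' x] b zero_le_dist[of p x] by linarith
    ultimately show ?thesis
      using K(2) by simp
  qed
  with K(1) show ?thesis using that by blast
qed

lemma coarse_structure_ulog: "coarse_structure (O_entourages ulog (p :: 'a::metric_space))"
  unfolding coarse_structure_def
proof (intro conjI ballI allI impI)
  show "Id \<in> O_entourages ulog p"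
    unfolding O_entourages_ulog_iff by (intro exI[of _ 0]) auto
next
  fix E F assume "E \<in> O_entourages ulog p" "F \<in> O_entourages ulog p"
  then obtain C D where C: "C \<ge> 0" "\<And>x x'. (x, x') \<in> E \<Longrightarrow> dist x x' \<le> C * ulog (dist p x)"
    and D: "D \<ge> 0" "\<And>x x'. (x, x') \<in> F \<Longrightarrow> dist x x' \<le> D * ulog (dist p x)"
    unfolding O_entourages_ulog_iff by blast
  obtain K where K: "K \<ge> 0"
    "\<And>(p::'a) x x'. dist x x' \<le> C * ulog (dist p x) \<Longrightarrow>
        ulog (dist p x) \<le> K * ulog (dist p x') \<and> ulog (dist p x') \<le> K * ulog (dist p x)"
    using ulog_near[OF C(1)] by metis
  have "dist x z \<le> (C + D * K) * ulog (dist p x)" if "(x, y) \<in> E" "(y, z) \<in> F" for x y z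
  proof -
    have "dist x z \<le> dist x y + dist y z" by (rule dist_triangle)
    also have "\<dots> \<le> C * ulog (dist p x) + D * ulog (dist p y)"
      using C(2) D(2) that by (intro add_mono) auto
    also have "D * ulog (dist p y) \<le> D * (K * ulog (dist p x))"
      using K(2) C(2) that D(1) by (intro mult_left_mono) auto
    finally show ?thesis by (simp add: algebra_simps)
  qed
  then show "E O F \<in> O_entourages ulog p"
    unfolding O_entourages_ulog_iff using C(1) D(1) K(1)
    by (intro exI[of _ "C + D * K"]) auto
  have "dist x y \<le> (C + D) * ulog (dist p x)" if "(x, y) \<in> E \<union> F" for x y
  proof -
    have "0 \<le> C * ulog (dist p x)" "0 \<le> D * ulog (dist p x)"
      using C(1) D(1) ulog_pos[of "dist p x"] by auto
    then show ?thesis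
      using that C(2)[of x y] D(2)[of x y] by (auto simp: algebra_simps)
  qed
  then show "E \<union> F \<in> O_entourages ulog p"
    unfolding O_entourages_ulog_iff using C(1) D(1)
    by (intro exI[of _ "C + D"]) auto
next
  fix E assume "E \<in> O_entourages ulog p"
  then obtain C where C: "C \<ge> 0" "\<And>x x'. (x, x') \<in> E \<Longrightarrow> dist x x' \<le> C * ulog (dist p x)"
    unfolding O_entourages_ulog_iff by blast
  obtain K where K: "K \<ge> 0"
    "\<And>(p::'a) x x'. dist x x' \<le> C * ulog (dist p x) \<Longrightarrow>
        ulog (dist p x) \<le> K * ulog (dist p x') \<and> ulog (dist p x') \<le> K * ulog (dist p x)"
    using ulog_near[OF C(1)] by metis
  have "dist y x \<le> (C * K) * ulog (dist p y)" if "(x, y) \<in> E" for x y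
  proof -
    have "dist y x \<le> C * ulog (dist p x)"
      using C(2)[OF that] by (simp add: dist_commute[of y x])
    also have "\<dots> \<le> C * (K * ulog (dist p y))"
      using K(2) C that by (intro mult_left_mono) auto
    finally show ?thesis by (simp add: algebra_simps)
  qed
  then show "E\<inverse> \<in> O_entourages ulog p"
    unfolding O_entourages_ulog_iff using C(1) K(1) by (intro exI[of _ "C * K"]) auto
next
  fix E F assume "E \<in> O_entourages ulog p" "F \<subseteq> E"
  then show "F \<in> O_entourages ulog p"
    unfolding O_entourages_ulog_iff by blast
qed

end

theory Submission
  imports Defs
begin

text \<open>
  Both notions say the same thing about \<open>\<phi>\<close>: it has a map \<open>\<psi>\<close> in the opposite direction such that
  \<open>\<phi>\<close> and \<open>\<psi>\<close> are Lipschitz up to an additive logarithmic error and \<open>\<psi> \<circ> \<phi>\<close>, \<open>\<phi> \<circ> \<psi>\<close> are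
  logarithmically close to the identity. A map with such a \<open>\<psi>\<close> is called a log-Lipschitz
  equivalence below.

  For bilipschitz equivalences (\<open>O_bilipschitz_equivalence_iff\<close>) this is the usual passage between
  an almost surjective quasi-isometric embedding and a quasi-inverse. The logarithmic errors cause
  no harm, because they are sublinear: they can be absorbed when \<open>|x|\<close> and \<open>|\<phi> x|\<close> are compared,
  so these two norms bound each other linearly up to constants and their logarithms are comparable.

  For coarse equivalences (\<open>coarse_equivalence_iff\<close>), one direction
  (\<open>coarse_map_if_log_lipschitz\<close>) rests on the same comparison of logarithms. The other one
  (\<open>log_lipschitz_if_controlled\<close>) is the heart of the matter and the place where geodesics enter.
  A controlled map \<open>f\<close> sends pairs at
  distance at most \<open>2 log |x|\<close> to pairs at distance at most \<open>L log |f x|\<close>. A walk from the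
  basepoint along a geodesic, in steps of length at most 1, then shows that \<open>|f x|\<close> grows at most
  quadratically in \<open>|x|\<close>. Since \<open>log (r\<^sup>2) = 2 log r\<close>, already this crude bound gives
  \<open>log |f x| = O(log |x|)\<close>. Hence a step of length exactly \<open>log |x|\<close> starting at \<open>x\<close> is expanded by
  \<open>f\<close> at most by a constant factor, and a walk along a geodesic from \<open>x\<close> to \<open>x'\<close> by such steps
  yields the Lipschitz bound, where the last, incomplete step produces the logarithmic error.
\<close>

section \<open>Elementary estimates for the logarithm\<close>

lemma ulog_max_le: "ulog (max r s) \<le> ulog r + ulog s"
  using ulog_pos[of r] ulog_pos[of s] by (auto simp: max_def)

lemma one_le_two_ulog: "1 \<le> 2 * ulog r"
  using ulog_ge[of r] ln2_ge_two_thirds by linarith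

text \<open>A logarithm is sublinear, so that any multiple of it can be absorbed into half the
  argument.\<close>

lemma ulog_absorb:
  assumes "C \<ge> 0"
  obtains b where "b \<ge> 0" "\<And>r. r \<ge> 0 \<Longrightarrow> C * ulog r \<le> r / 2 + b"
proof -
  define b where "b = C + 2 * C\<^sup>2"
  have "C * ulog r \<le> r / 2 + b" if "r \<ge> 0" for r
  proof -
    define t where "t = sqrt r"
    have t: "r = t\<^sup>2" using that by (simp add: t_def)
    have "C * ulog r \<le> C * (1 + 2 * t)"
      using assms ulog_le_sqrt[OF that] by (intro mult_left_mono) (auto simp: t_def)
    also have "\<dots> \<le> t\<^sup>2 / 2 + b"
      using zero_le_power2[of "t - 2 * C"]
      by (simp add: b_def power2_eq_square field_simps)
    finally show ?thesis using t by simp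
  qed
  moreover have "b \<ge> 0" using assms by (simp add: b_def)
  ultimately show ?thesis using that by blast
qed

lemma ulog_le_ulog_sqrt: "ulog s \<le> 2 * ulog (sqrt s)"
proof (cases "s \<ge> 4")
  case True
  then have "sqrt s \<ge> 2" by (intro real_le_rsqrt) auto
  then show ?thesis using True by (simp add: ulog_def ln_sqrt)
next
  case False
  show ?thesis
  proof (cases "s \<ge> 2")
    case True
    have "ln s \<le> ln (2 * 2)" using True False by simp
    also have "\<dots> = 2 * ln 2" by (subst ln_mult) auto
    also have "\<dots> \<le> 2 * ulog (sqrt s)" using ulog_ge by simp
    finally show ?thesis using True by (simp add: ulog_def)
  next
    case False
    then have "ulog s = 1" by (simp add: ulog_def)
    then show ?thesis using one_le_two_ulog by metis
  qed
qed

text \<open>Polynomial growth is enough to compare logarithms. This property of the logarithm fails for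
  the powers \<open>r powr \<alpha>\<close> with \<open>0 < \<alpha> < 1\<close>, which are also sublinear.\<close>

lemma ulog_quadratic_bound:
  assumes "A \<ge> 0" "b \<ge> 0"
  obtains K where "K \<ge> 0"
    "\<And>r s. 0 \<le> r \<Longrightarrow> 0 \<le> s \<Longrightarrow> s \<le> A * (r + b)\<^sup>2 \<Longrightarrow> ulog s \<le> K * ulog r"
proof -
  obtain K where K: "K \<ge> 0" "\<And>r s. 0 \<le> r \<Longrightarrow> 0 \<le> s \<Longrightarrow>
      s \<le> sqrt A * r + sqrt A * b \<Longrightarrow> ulog s \<le> K * ulog r"
    using ulog_linear_bound[of "sqrt A" "sqrt A * b"] assms by auto
  have "ulog s \<le> (2 * K) * ulog r" if "0 \<le> r" "0 \<le> s" "s \<le> A * (r + b)\<^sup>2" for r s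
  proof -
    have "sqrt s \<le> sqrt (A * (r + b)\<^sup>2)" using that by simp
    also have "\<dots> = sqrt A * r + sqrt A * b"
      using that assms by (simp add: real_sqrt_mult algebra_simps)
    finally have "ulog (sqrt s) \<le> K * ulog r" using that K(2) by simp
    then show ?thesis using ulog_le_ulog_sqrt[of s] by linarith
  qed
  then show ?thesis using K(1) that[of "2 * K"] by auto
qed


section \<open>Log-Lipschitz maps\<close>

definition log_lipschitz :: "'a::metric_space \<Rightarrow> ('a \<Rightarrow> 'b::metric_space) \<Rightarrow> bool" where
  "log_lipschitz p f \<longleftrightarrow>
     (\<exists>L\<ge>0. \<forall>x x'. dist (f x) (f x') \<le> L * (dist x x' + ulog (dist p x) + ulog (dist p x')))"

definition log_close_to_id :: "'a::metric_space \<Rightarrow> ('a \<Rightarrow> 'a) \<Rightarrow> bool" where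
  "log_close_to_id p h \<longleftrightarrow> (\<exists>C\<ge>0. \<forall>x. dist x (h x) \<le> C * ulog (dist p x))"

definition log_lipschitz_equivalence ::
    "'a::metric_space \<Rightarrow> 'b::metric_space \<Rightarrow> ('a \<Rightarrow> 'b) \<Rightarrow> bool" where
  "log_lipschitz_equivalence p q \<phi> \<longleftrightarrow>
     (\<exists>\<psi>. log_lipschitz p \<phi> \<and> log_lipschitz q \<psi> \<and>
          log_close_to_id p (\<psi> \<circ> \<phi>) \<and> log_close_to_id q (\<phi> \<circ> \<psi>))"

lemma log_lipschitz_linear_growth:
  assumes "log_lipschitz p f"
  obtains a b where "a \<ge> 0" "b \<ge> 0" "\<And>x. dist q (f x) \<le> a * dist p x + b"
proof -
  obtain L where L: "L \<ge> 0"
    "\<And>x x'. dist (f x) (f x') \<le> L * (dist x x' + ulog (dist p x) + ulog (dist p x'))"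
    using assms by (auto simp: log_lipschitz_def)
  obtain b where b: "b \<ge> 0" "\<And>r. r \<ge> 0 \<Longrightarrow> L * ulog r \<le> r / 2 + b"
    using ulog_absorb[OF L(1)] by blast
  have "dist q (f x) \<le> (L + 1 / 2) * dist p x + (dist q (f p) + L + b)" for x
  proof -
    have "dist (f p) (f x) \<le> L * dist p x + L + L * ulog (dist p x)"
      using L(2)[of p x] by (simp add: algebra_simps ulog_def)
    then show ?thesis
      using b(2)[of "dist p x"] dist_triangle[of q "f x" "f p"] by (simp add: algebra_simps)
  qed
  then show ?thesis using that[of "L + 1/2" "dist q (f p) + L + b"] L(1) b(1) by auto
qed

lemma ulog_comparison_if_linear_growth:
  fixes f :: "'c \<Rightarrow> 'a::metric_space" and g :: "'c \<Rightarrow> 'b::metric_space"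
  assumes "a \<ge> 0" "b \<ge> 0" "\<And>x. dist q (f x) \<le> a * dist p (g x) + b"
  obtains K where "K \<ge> 0" "\<And>x. ulog (dist q (f x)) \<le> K * ulog (dist p (g x))"
proof -
  obtain K where "K \<ge> 0"
    "\<And>r s. 0 \<le> r \<Longrightarrow> 0 \<le> s \<Longrightarrow> s \<le> a * r + b \<Longrightarrow> ulog s \<le> K * ulog r"
    using ulog_linear_bound[OF assms(1,2)] by metis
  then show ?thesis using that[of K] assms(3) by simp
qed

text \<open>With a log-Lipschitz left quasi-inverse \<open>g\<close> one has
  \<open>|x| \<le> |g (f x)| + O(log |x|) \<le> O(|f x|) + |x|/2 + O(1)\<close>.\<close>

lemma linear_growth_from_left_quasi_inverse:
  assumes "log_lipschitz q g" "log_close_to_id p (g \<circ> f)"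
  obtains a b where "a \<ge> 0" "b \<ge> 0" "\<And>x. dist p x \<le> a * dist q (f x) + b"
proof -
  obtain a b where ab: "a \<ge> 0" "b \<ge> 0" "\<And>y. dist p (g y) \<le> a * dist q y + b"
    using log_lipschitz_linear_growth[OF assms(1)] by blast
  obtain C where C: "C \<ge> 0" "\<And>x. dist x (g (f x)) \<le> C * ulog (dist p x)"
    using assms(2) by (auto simp: log_close_to_id_def)
  obtain c where c: "c \<ge> 0" "\<And>r. r \<ge> 0 \<Longrightarrow> C * ulog r \<le> r / 2 + c"
    using ulog_absorb[OF C(1)] by blast
  have "dist p x \<le> 2 * a * dist q (f x) + 2 * (b + c)" for x
    using ab(3)[of "f x"] C(2)[of x] c(2)[of "dist p x"]
      dist_triangle2[of p x "g (f x)"] by simp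
  then show ?thesis using that[of "2 * a" "2 * (b + c)"] ab c by auto
qed


section \<open>Bilipschitz equivalences are the log-Lipschitz equivalences\<close>

lemma O_bilipschitz_if_log_lipschitz_equivalence:
  assumes "log_lipschitz_equivalence p q \<phi>"
  shows "O_bilipschitz_equivalence ulog p q \<phi>"
proof -
  obtain \<psi> where \<psi>: "log_lipschitz p \<phi>" "log_lipschitz q \<psi>"
    "log_close_to_id p (\<psi> \<circ> \<phi>)" "log_close_to_id q (\<phi> \<circ> \<psi>)"
    using assms by (auto simp: log_lipschitz_equivalence_def)
  obtain L where L: "L \<ge> 0" "\<And>x x'. dist (\<phi> x) (\<phi> x') \<le>
      L * (dist x x' + ulog (dist p x) + ulog (dist p x'))"
    using \<psi>(1) by (auto simp: log_lipschitz_def)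
  obtain M where M: "M \<ge> 0" "\<And>y y'. dist (\<psi> y) (\<psi> y') \<le>
      M * (dist y y' + ulog (dist q y) + ulog (dist q y'))"
    using \<psi>(2) by (auto simp: log_lipschitz_def)
  obtain C where C: "C \<ge> 0" "\<And>x. dist x (\<psi> (\<phi> x)) \<le> C * ulog (dist p x)"
    using \<psi>(3) by (auto simp: log_close_to_id_def)
  obtain D where D: "D \<ge> 0" "\<And>y. dist y (\<phi> (\<psi> y)) \<le> D * ulog (dist q y)"
    using \<psi>(4) by (auto simp: log_close_to_id_def)
  obtain a b where "a \<ge> 0" "b \<ge> 0" "\<And>x. dist q (\<phi> x) \<le> a * dist p x + b"
    using log_lipschitz_linear_growth[OF \<psi>(1)] by blast
  then obtain K where K: "K \<ge> 0" "\<And>x. ulog (dist q (\<phi> x)) \<le> K * ulog (dist p x)"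
    using ulog_comparison_if_linear_growth[of a b q \<phi> p "\<lambda>x. x"] by blast
  \<comment> \<open>The function \<open>ulog\<close> is not monotone, hence the constant \<open>J\<close>.\<close>
  obtain J where J: "J \<ge> 0" "\<And>r s. 0 \<le> r \<Longrightarrow> 0 \<le> s \<Longrightarrow> s \<le> 1 * r + 0 \<Longrightarrow> ulog s \<le> J * ulog r"
    using ulog_linear_bound[of 1 0] by auto
  have sum_le_max: "ulog (dist p x) + ulog (dist p x') \<le> 2 * J * ulog (max (dist p x) (dist p x'))"
    for x x'
    using J(2)[of "max (dist p x) (dist p x')" "dist p x"]
      J(2)[of "max (dist p x) (dist p x')" "dist p x'"] by (simp add: le_max_iff_disj)
  define \<kappa> where "\<kappa> = L + M + 1"
  define B where "B = C + M * K"
  define c where "c = (L + B) * (2 * J) + D"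
  have nonneg: "\<kappa> \<ge> 1" "B \<ge> 0" "c \<ge> 0"
    using L M C K J D by (auto simp: \<kappa>_def B_def c_def)
  have upper: "dist (\<phi> x) (\<phi> x') \<le> \<kappa> * dist x x' + c * ulog (max (dist p x) (dist p x'))"
    for x x'
  proof -
    let ?u = "ulog (max (dist p x) (dist p x'))"
    have u: "?u \<ge> 0" using ulog_pos less_imp_le by blast
    have "dist (\<phi> x) (\<phi> x') \<le> L * dist x x' + L * (ulog (dist p x) + ulog (dist p x'))"
      using L(2)[of x x'] by (simp add: algebra_simps)
    also have "\<dots> \<le> \<kappa> * dist x x' + L * (2 * J * ?u)"
      using L(1) M(1) sum_le_max
      by (intro add_mono mult_left_mono mult_right_mono) (auto simp: \<kappa>_def)
    also have "L * (2 * J * ?u) \<le> c * ?u"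
      using nonneg D J u by (simp add: c_def algebra_simps)
    finally show ?thesis by simp
  qed
  have lower: "- c * ulog (max (dist p x) (dist p x')) + (1 / \<kappa>) * dist x x' \<le> dist (\<phi> x) (\<phi> x')"
    for x x'
  proof -
    let ?u = "ulog (max (dist p x) (dist p x'))"
    have u: "?u \<ge> 0" using ulog_pos less_imp_le by blast
    have "dist x x' \<le> dist x (\<psi> (\<phi> x)) + dist (\<psi> (\<phi> x)) (\<psi> (\<phi> x')) + dist x' (\<psi> (\<phi> x'))"
      using dist_triangle[of x x' "\<psi> (\<phi> x)"] dist_triangle2[of "\<psi> (\<phi> x)" x' "\<psi> (\<phi> x')"]
      by linarith
    also have "\<dots> \<le> C * ulog (dist p x)
        + M * (dist (\<phi> x) (\<phi> x') + K * ulog (dist p x) + K * ulog (dist p x'))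
        + C * ulog (dist p x')"
      using C(2) by (intro add_mono order.trans[OF M(2)] mult_left_mono M(1) K(2)) auto
    also have "\<dots> = M * dist (\<phi> x) (\<phi> x') + B * (ulog (dist p x) + ulog (dist p x'))"
      by (simp add: B_def algebra_simps)
    also have "\<dots> \<le> \<kappa> * dist (\<phi> x) (\<phi> x') + B * (2 * J * ?u)"
      using L(1) nonneg sum_le_max
      by (intro add_mono mult_left_mono mult_right_mono) (auto simp: \<kappa>_def)
    also have "B * (2 * J * ?u) \<le> c * ?u"
      using L D J u by (simp add: c_def algebra_simps)
    also have "c * ?u \<le> \<kappa> * (c * ?u)"
      using mult_right_mono[of 1 \<kappa> "c * ?u"] nonneg u by simp
    finally have "dist x x' \<le> \<kappa> * (dist (\<phi> x) (\<phi> x') + c * ?u)"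
      by (simp add: algebra_simps)
    then show ?thesis
      using nonneg by (simp add: field_simps)
  qed
  have dense: "infdist y (range \<phi>) \<le> c * ulog (dist q y)" for y
  proof -
    have "infdist y (range \<phi>) \<le> D * ulog (dist q y)"
      using D(2)[of y] infdist_le[of "\<phi> (\<psi> y)" "range \<phi>" y] by simp
    also have "\<dots> \<le> c * ulog (dist q y)"
      using L nonneg J ulog_pos[of "dist q y"] by (intro mult_right_mono) (auto simp: c_def)
    finally show ?thesis .
  qed
  show ?thesis
    unfolding O_bilipschitz_equivalence_def using nonneg upper lower dense by blast
qed

text \<open>A quasi-inverse \<open>\<psi>\<close> is chosen so that \<open>\<phi> (\<psi> y)\<close> almost realises the distance from \<open>y\<close> to the
  image of \<open>\<phi>\<close>. The lower bilipschitz bound makes \<open>\<psi>\<close> log-Lipschitz, once \<open>log |\<psi> y|\<close> is known to be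
  \<open>O(log |y|)\<close>.\<close>

lemma log_lipschitz_equivalence_if_O_bilipschitz:
  assumes "O_bilipschitz_equivalence ulog p q \<phi>"
  shows "log_lipschitz_equivalence p q \<phi>"
proof -
  obtain \<kappa> c where \<kappa>: "\<kappa> \<ge> 1" and c: "c \<ge> 0"
    and lower0: "\<And>x x'. - c * ulog (max (dist p x) (dist p x')) + (1 / \<kappa>) * dist x x'
                    \<le> dist (\<phi> x) (\<phi> x')"
    and upper0: "\<And>x x'. dist (\<phi> x) (\<phi> x')
                    \<le> \<kappa> * dist x x' + c * ulog (max (dist p x) (dist p x'))"
    and dense: "\<And>y. infdist y (range \<phi>) \<le> c * ulog (dist q y)"
    using assms unfolding O_bilipschitz_equivalence_def by blast
  define A where "A = \<kappa> * (c + 1)"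
  have A: "A \<ge> 1" "A \<ge> \<kappa>" "A \<ge> c" "A \<ge> \<kappa> * c" "A \<ge> c + 1"
  proof -
    have "\<kappa> * c \<ge> 1 * c" using \<kappa> c by (intro mult_right_mono)
    moreover have "\<kappa> * c \<ge> 0" using \<kappa> c by simp
    ultimately show "A \<ge> 1" "A \<ge> \<kappa>" "A \<ge> c" "A \<ge> \<kappa> * c" "A \<ge> c + 1"
      using \<kappa> c by (auto simp: A_def algebra_simps)
  qed
  have upper: "dist (\<phi> x) (\<phi> x') \<le> A * (dist x x' + ulog (dist p x) + ulog (dist p x'))" for x x'
  proof -
    have "dist (\<phi> x) (\<phi> x') \<le> \<kappa> * dist x x' + c * ulog (max (dist p x) (dist p x'))"
      by (rule upper0)
    also have "\<dots> \<le> A * dist x x' + A * (ulog (dist p x) + ulog (dist p x'))"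
      using A c ulog_max_le by (intro add_mono mult_mono less_imp_le[OF ulog_pos]) auto
    finally show ?thesis by (simp add: algebra_simps)
  qed
  have lower: "dist x x' \<le> A * (dist (\<phi> x) (\<phi> x') + ulog (dist p x) + ulog (dist p x'))" for x x'
  proof -
    have "dist x x' \<le> \<kappa> * dist (\<phi> x) (\<phi> x') + (\<kappa> * c) * ulog (max (dist p x) (dist p x'))"
      using lower0[of x x'] \<kappa> by (simp add: field_simps)
    also have "\<dots> \<le> A * dist (\<phi> x) (\<phi> x') + A * (ulog (dist p x) + ulog (dist p x'))"
      using A c \<kappa> ulog_max_le by (intro add_mono mult_mono less_imp_le[OF ulog_pos]) auto
    finally show ?thesis by (simp add: algebra_simps)
  qed
  have lip: "log_lipschitz p \<phi>"
    unfolding log_lipschitz_def using upper A(1) by (intro exI[of _ A]) auto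

  have "\<exists>x. dist y (\<phi> x) \<le> A * ulog (dist q y)" for y
  proof -
    have u: "ulog (dist q y) > 0" by (rule ulog_pos)
    have "infdist y (range \<phi>) < (c + 1) * ulog (dist q y)"
      using dense[of y] u by (simp add: algebra_simps)
    then obtain x where "dist y (\<phi> x) < (c + 1) * ulog (dist q y)"
      unfolding infdist_def by (auto simp: cInf_less_iff)
    also have "\<dots> \<le> A * ulog (dist q y)" using A u by (intro mult_right_mono) auto
    finally show ?thesis by (auto intro: less_imp_le)
  qed
  then obtain \<psi> where \<psi>: "\<And>y. dist y (\<phi> (\<psi> y)) \<le> A * ulog (dist q y)" by metis

  obtain b where b: "b \<ge> 0" "\<And>r. r \<ge> 0 \<Longrightarrow> A * ulog r \<le> r / 2 + b"
    using ulog_absorb[of A] A by auto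
  have proper: "dist p x \<le> 2 * A * dist q (\<phi> x) + 2 * (A * (dist q (\<phi> p) + 1) + b)" for x
  proof -
    have "dist p x \<le> A * (dist (\<phi> p) (\<phi> x) + 1 + ulog (dist p x))"
      using lower[of p x] by (simp add: ulog_def)
    also have "\<dots> \<le> A * (dist q (\<phi> x) + dist q (\<phi> p) + 1 + ulog (dist p x))"
      using A dist_triangle3[of "\<phi> p" "\<phi> x" q] by (intro mult_left_mono) auto
    finally show ?thesis using b(2)[of "dist p x"] by (simp add: algebra_simps)
  qed
  define b' where "b' = 2 * (A * (dist q (\<phi> p) + 1) + b) + 2 * A * b"
  have b': "b' \<ge> 0" using A b(1) by (simp add: b'_def)
  have growth: "dist p (\<psi> y) \<le> 3 * A * dist q y + b'" for y
  proof -
    have "dist q (\<phi> (\<psi> y)) \<le> dist q y + A * ulog (dist q y)"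
      using \<psi>[of y] dist_triangle[of q "\<phi> (\<psi> y)" y] by linarith
    also have "\<dots> \<le> 3 / 2 * dist q y + b" using b(2)[of "dist q y"] by simp
    finally have "2 * A * dist q (\<phi> (\<psi> y)) \<le> 2 * A * (3 / 2 * dist q y + b)"
      using A by (intro mult_left_mono) auto
    then show ?thesis using proper[of "\<psi> y"] by (simp add: b'_def algebra_simps)
  qed
  obtain K where K: "K \<ge> 0" "\<And>y. ulog (dist p (\<psi> y)) \<le> K * ulog (dist q y)"
    using ulog_comparison_if_linear_growth[of "3 * A" b' p \<psi> q "\<lambda>y. y"] A(1) b' growth
    by auto
  obtain a d where "a \<ge> 0" "d \<ge> 0" "\<And>x. dist q (\<phi> x) \<le> a * dist p x + d"
    using log_lipschitz_linear_growth[OF lip] by blast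
  then obtain H where H: "H \<ge> 0" "\<And>x. ulog (dist q (\<phi> x)) \<le> H * ulog (dist p x)"
    using ulog_comparison_if_linear_growth[of a d q \<phi> p "\<lambda>x. x"] by blast

  have "dist (\<psi> y) (\<psi> y') \<le> A * (1 + A + K) * (dist y y' + ulog (dist q y) + ulog (dist q y'))"
    for y y'
  proof -
    have "dist (\<phi> (\<psi> y)) (\<phi> (\<psi> y')) \<le> dist y y' + dist y (\<phi> (\<psi> y)) + dist y' (\<phi> (\<psi> y'))"
      using dist_triangle3[of "\<phi> (\<psi> y)" "\<phi> (\<psi> y')" y] dist_triangle[of y "\<phi> (\<psi> y')" y']
      by linarith
    then have *: "dist (\<phi> (\<psi> y)) (\<phi> (\<psi> y')) \<le>
        dist y y' + A * ulog (dist q y) + A * ulog (dist q y')"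
      using \<psi>[of y] \<psi>[of y'] by linarith
    have "dist (\<psi> y) (\<psi> y') \<le>
        A * (dist (\<phi> (\<psi> y)) (\<phi> (\<psi> y')) + ulog (dist p (\<psi> y)) + ulog (dist p (\<psi> y')))"
      by (rule lower)
    also have "\<dots> \<le> A * ((dist y y' + A * ulog (dist q y) + A * ulog (dist q y'))
        + K * ulog (dist q y) + K * ulog (dist q y'))"
      using A * K by (intro mult_left_mono add_mono) auto
    also have "\<dots> \<le> A * ((1 + A + K) * (dist y y' + ulog (dist q y) + ulog (dist q y')))"
      using A K ulog_pos[of "dist q y"] ulog_pos[of "dist q y'"]
      by (intro mult_left_mono) (simp_all add: algebra_simps)
    finally show ?thesis by simp
  qed
  then have "log_lipschitz q \<psi>"
    unfolding log_lipschitz_def using A K by (intro exI[of _ "A * (1 + A + K)"]) auto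
  moreover have "dist x (\<psi> (\<phi> x)) \<le> A * (A * H + 1 + K * H) * ulog (dist p x)" for x
  proof -
    have "ulog (dist p (\<psi> (\<phi> x))) \<le> K * ulog (dist q (\<phi> x))" by (rule K(2))
    also have "\<dots> \<le> K * (H * ulog (dist p x))" using K H by (intro mult_left_mono)
    finally have *: "ulog (dist p (\<psi> (\<phi> x))) \<le> K * H * ulog (dist p x)" by simp
    have "dist (\<phi> x) (\<phi> (\<psi> (\<phi> x))) \<le> A * ulog (dist q (\<phi> x))" by (rule \<psi>)
    also have "\<dots> \<le> A * (H * ulog (dist p x))" using A H by (intro mult_left_mono) auto
    finally have "dist (\<phi> x) (\<phi> (\<psi> (\<phi> x))) \<le> A * H * ulog (dist p x)" by simp
    then have "A * (dist (\<phi> x) (\<phi> (\<psi> (\<phi> x))) + ulog (dist p x) + ulog (dist p (\<psi> (\<phi> x))))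
        \<le> A * (A * H * ulog (dist p x) + ulog (dist p x) + K * H * ulog (dist p x))"
      using * A by (intro mult_left_mono add_mono) auto
    then show ?thesis using lower[of x "\<psi> (\<phi> x)"] by (simp add: algebra_simps)
  qed
  then have "log_close_to_id p (\<psi> \<circ> \<phi>)"
    unfolding log_close_to_id_def using A K H
    by (intro exI[of _ "A * (A * H + 1 + K * H)"]) auto
  moreover have "log_close_to_id q (\<phi> \<circ> \<psi>)"
    unfolding log_close_to_id_def using A \<psi> by (intro exI[of _ A]) auto
  ultimately show ?thesis
    unfolding log_lipschitz_equivalence_def using lip by blast
qed

lemma O_bilipschitz_equivalence_iff:
  "O_bilipschitz_equivalence ulog p q \<phi> \<longleftrightarrow> log_lipschitz_equivalence p q \<phi>"
  using O_bilipschitz_if_log_lipschitz_equivalence log_lipschitz_equivalence_if_O_bilipschitz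
  by blast


section \<open>Coarse equivalences of geodesic spaces are the log-Lipschitz equivalences\<close>

lemma log_close_to_id_iff_entourage:
  "log_close_to_id p h \<longleftrightarrow> (\<exists>E\<in>O_entourages ulog p. range (\<lambda>x. (x, h x)) \<subseteq> E)"
proof
  assume "log_close_to_id p h"
  then have "range (\<lambda>x. (x, h x)) \<in> O_entourages ulog p"
    unfolding log_close_to_id_def O_entourages_ulog_iff by auto
  then show "\<exists>E\<in>O_entourages ulog p. range (\<lambda>x. (x, h x)) \<subseteq> E" by blast
next
  assume "\<exists>E\<in>O_entourages ulog p. range (\<lambda>x. (x, h x)) \<subseteq> E"
  then obtain E where E: "E \<in> O_entourages ulog p" "range (\<lambda>x. (x, h x)) \<subseteq> E"
    by (elim bexE)
  from E(1) obtain C where C: "C \<ge> 0"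
    "\<And>x x'. (x, x') \<in> E \<Longrightarrow> dist x x' \<le> C * ulog (dist p x)"
    unfolding O_entourages_ulog_iff by blast
  have "dist x (h x) \<le> C * ulog (dist p x)" for x using E(2) by (intro C(2)) auto
  with C(1) show "log_close_to_id p h"
    unfolding log_close_to_id_def by blast
qed

lemma bounded_if_square_entourage:
  assumes "B \<times> B \<in> O_entourages ulog p"
  obtains R where "\<And>x. x \<in> B \<Longrightarrow> dist p x \<le> R"
proof (cases "B = {}")
  case False
  then obtain z where z: "z \<in> B" by blast
  obtain C where C: "\<And>x x'. x \<in> B \<Longrightarrow> x' \<in> B \<Longrightarrow> dist x x' \<le> C * ulog (dist p x)"
    using assms unfolding O_entourages_ulog_iff by blast
  have "dist p x \<le> dist p z + C * ulog (dist p z)" if "x \<in> B" for x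
    using C[OF z that] dist_triangle[of p x z] by linarith
  then show ?thesis using that by blast
qed (use that in blast)

lemma square_entourage_if_bounded:
  assumes "\<And>x. x \<in> B \<Longrightarrow> dist p x \<le> R"
  shows "B \<times> B \<in> O_entourages ulog p"
proof -
  have "dist x x' \<le> (4 * \<bar>R\<bar>) * ulog (dist p x)" if "x \<in> B" "x' \<in> B" for x x'
  proof -
    have "dist x x' \<le> 2 * \<bar>R\<bar> * 1"
      using assms[OF that(1)] assms[OF that(2)] dist_triangle3[of x x' p] by linarith
    also have "\<dots> \<le> 2 * \<bar>R\<bar> * (2 * ulog (dist p x))"
      by (intro mult_left_mono one_le_two_ulog) auto
    finally show ?thesis by simp
  qed
  then show ?thesis unfolding O_entourages_ulog_iff by (intro exI[of _ "4 * \<bar>R\<bar>"]) auto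
qed

text \<open>The left quasi-inverse \<open>g\<close> serves to bound \<open>|x|\<close> by \<open>|f x|\<close>: this makes \<open>f\<close> proper, and it
  turns bounds by \<open>log |x|\<close> into the bounds by \<open>log |f x|\<close> that entourages of the target demand.\<close>

lemma coarse_map_if_log_lipschitz:
  assumes f: "log_lipschitz p f" and g: "log_lipschitz q g" and gf: "log_close_to_id p (g \<circ> f)"
  shows "coarse_map (O_entourages ulog p) (O_entourages ulog q) f"
proof -
  obtain L where L: "L \<ge> 0"
    "\<And>x x'. dist (f x) (f x') \<le> L * (dist x x' + ulog (dist p x) + ulog (dist p x'))"
    using f by (auto simp: log_lipschitz_def)
  obtain a b where ab: "a \<ge> 0" "b \<ge> 0" "\<And>x. dist p x \<le> a * dist q (f x) + b"
    using linear_growth_from_left_quasi_inverse[OF g gf] by blast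
  obtain K where K: "K \<ge> 0" "\<And>x. ulog (dist p x) \<le> K * ulog (dist q (f x))"
    using ulog_comparison_if_linear_growth[of a b p "\<lambda>x. x" q f] ab by blast
  show ?thesis
    unfolding coarse_map_def
  proof (intro conjI allI impI ballI)
    fix B assume "B \<times> B \<in> O_entourages ulog q"
    then obtain R where R: "\<And>y. y \<in> B \<Longrightarrow> dist q y \<le> R"
      using bounded_if_square_entourage by metis
    have "dist p x \<le> a * R + b" if "x \<in> f -` B" for x
    proof -
      have "a * dist q (f x) \<le> a * R" using that R ab(1) by (intro mult_left_mono) auto
      then show ?thesis using ab(3)[of x] by linarith
    qed
    then show "f -` B \<times> f -` B \<in> O_entourages ulog p"
      by (rule square_entourage_if_bounded)
  next
    fix E assume "E \<in> O_entourages ulog p"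
    then obtain C where C: "C \<ge> 0" "\<And>x x'. (x, x') \<in> E \<Longrightarrow> dist x x' \<le> C * ulog (dist p x)"
      unfolding O_entourages_ulog_iff by blast
    obtain J where J: "J \<ge> 0" "\<And>(p::'a) x x'. dist x x' \<le> C * ulog (dist p x) \<Longrightarrow>
        ulog (dist p x) \<le> J * ulog (dist p x') \<and> ulog (dist p x') \<le> J * ulog (dist p x)"
      using ulog_near[OF C(1)] by metis
    have "dist (f x) (f x') \<le> L * (C + 1 + J) * K * ulog (dist q (f x))" if "(x, x') \<in> E" for x x'
    proof -
      have "dist (f x) (f x') \<le> L * (dist x x' + ulog (dist p x) + ulog (dist p x'))"
        by (rule L(2))
      also have "\<dots> \<le> L * (C * ulog (dist p x) + ulog (dist p x) + J * ulog (dist p x))"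
        using L(1) C(2)[OF that] J(2)[OF C(2)[OF that]] by (intro mult_left_mono add_mono) auto
      also have "\<dots> = L * (C + 1 + J) * ulog (dist p x)" by (simp add: algebra_simps)
      also have "\<dots> \<le> L * (C + 1 + J) * (K * ulog (dist q (f x)))"
        using L C J K by (intro mult_left_mono) auto
      finally show ?thesis by (simp add: mult.assoc)
    qed
    then show "map_prod f f ` E \<in> O_entourages ulog q"
      unfolding O_entourages_ulog_iff using L C J K
      by (intro exI[of _ "L * (C + 1 + J) * K"]) auto
  qed
qed

lemma geodesic_point:
  fixes x y :: "'a::metric_space"
  assumes "geodesic_space TYPE('a)" and "0 \<le> t" "t \<le> dist x y"
  obtains z where "dist x z = t" "dist z y = dist x y - t"
proof -
  obtain \<gamma> where \<gamma>: "\<gamma> 0 = x" "\<gamma> (dist x y) = y"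
    "\<And>s t. s \<in> {0..dist x y} \<Longrightarrow> t \<in> {0..dist x y} \<Longrightarrow> dist (\<gamma> s) (\<gamma> t) = \<bar>s - t\<bar>"
    using assms(1) unfolding geodesic_space_def by metis
  show ?thesis
    using that[of "\<gamma> t"] \<gamma>(3)[of 0 t] \<gamma>(3)[of t "dist x y"] \<gamma>(1,2) assms(2,3) by auto
qed

text \<open>Each unit step away from \<open>p\<close> increases \<open>|f x|\<close> by at most \<open>L log |f x| = O(sqrt |f x|)\<close>, and
  the increments of \<open>A * n\<^sup>2\<close> are of this order.\<close>

lemma quadratic_growth_if_controlled:
  fixes p :: "'a::metric_space" and f :: "'a \<Rightarrow> 'b::metric_space"
  assumes geo: "geodesic_space TYPE('a)" and L: "L \<ge> 0"
    and step: "\<And>x x'. dist x x' \<le> 1 \<Longrightarrow> dist (f x) (f x') \<le> L * ulog (dist q (f x))"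
  obtains A where "A \<ge> 0" "\<And>x. dist q (f x) \<le> A * (dist p x + 2)\<^sup>2"
proof -
  \<comment> \<open>The constant dominates \<open>|f p|\<close>, \<open>L\<close> and \<open>L\<^sup>2\<close>.\<close>
  define A where "A = (1 + L)\<^sup>2 + dist q (f p)"
  have A: "A \<ge> 0" "L \<le> A" "dist q (f p) \<le> A" "L\<^sup>2 \<le> A"
    using L by (auto simp: A_def power2_eq_square algebra_simps)
  have LA: "L * sqrt A \<le> A"
  proof -
    have "L \<le> sqrt A" using A by (intro real_le_rsqrt)
    then have "L * sqrt A \<le> sqrt A * sqrt A" using A by (intro mult_right_mono) auto
    then show ?thesis using A by simp
  qed
  have ind: "dist q (f x) \<le> A * (real n + 1)\<^sup>2" if "dist p x \<le> real n" for n x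
    using that
  proof (induction n arbitrary: x)
    case 0
    then show ?case using A by simp
  next
    case (Suc n)
    obtain z where z: "dist p z = max 0 (dist p x - 1)" "dist z x = dist p x - max 0 (dist p x - 1)"
      using geodesic_point[OF geo, of "max 0 (dist p x - 1)" p x] by auto
    have IH: "dist q (f z) \<le> A * (real n + 1)\<^sup>2"
      using Suc z(1) by simp
    have "sqrt (dist q (f z)) \<le> sqrt (A * (real n + 1)\<^sup>2)" using IH by simp
    then have "sqrt (dist q (f z)) \<le> sqrt A * (real n + 1)"
      by (simp add: real_sqrt_mult)
    then have "1 + 2 * sqrt (dist q (f z)) \<le> 1 + 2 * (sqrt A * (real n + 1))" by simp
    then have "ulog (dist q (f z)) \<le> 1 + 2 * (sqrt A * (real n + 1))"
      using ulog_le_sqrt[of "dist q (f z)"] by simp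
    then have "L * ulog (dist q (f z)) \<le> L * (1 + 2 * (sqrt A * (real n + 1)))"
      using L by (rule mult_left_mono)
    also have "\<dots> = L + 2 * (L * sqrt A) * (real n + 1)" by (simp add: algebra_simps)
    also have "\<dots> \<le> A + 2 * A * (real n + 1)"
      using A LA by (intro add_mono mult_right_mono) auto
    finally have "L * ulog (dist q (f z)) \<le> A + 2 * A * (real n + 1)" .
    moreover have "dist (f z) (f x) \<le> L * ulog (dist q (f z))"
      using z(2) by (intro step) auto
    moreover have "A * (real n + 1)\<^sup>2 + (A + 2 * A * (real n + 1)) = A * (real (Suc n) + 1)\<^sup>2"
      by (simp add: power2_eq_square algebra_simps)
    ultimately show ?case
      using IH dist_triangle[of q "f x" "f z"] by linarith
  qed
  have "dist q (f x) \<le> A * (dist p x + 2)\<^sup>2" for x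
  proof -
    define n where "n = nat \<lceil>dist p x\<rceil>"
    have n: "dist p x \<le> real n" "real n \<le> dist p x + 1"
      unfolding n_def using of_int_ceiling_le_add_one[of "dist p x"]
      by (auto simp: real_nat_ceiling_ge)
    have "A * (real n + 1)\<^sup>2 \<le> A * (dist p x + 2)\<^sup>2"
      using A n by (intro mult_left_mono power_mono) auto
    then show ?thesis using ind[OF n(1)] by linarith
  qed
  then show ?thesis using that A(1) by blast
qed

text \<open>The step from \<open>x\<close> towards \<open>x'\<close> has length \<open>log |x|\<close>, which depends on the current point \<open>x\<close>
  and is bounded below, so that the walk terminates. Only the last step, whose length may be much
  smaller than the bound on its image, contributes to the error term.\<close>

lemma lipschitz_by_walking:
  fixes p :: "'a::metric_space" and f :: "'a \<Rightarrow> 'b::metric_space"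
  assumes geo: "geodesic_space TYPE('a)" and M: "M \<ge> 0"
    and step: "\<And>x x'. dist x x' \<le> ulog (dist p x) \<Longrightarrow> dist (f x) (f x') \<le> M * ulog (dist p x)"
    and near: "\<And>x x'. dist x x' \<le> ulog (dist p x) \<Longrightarrow> ulog (dist p x) \<le> K * ulog (dist p x')"
  shows "dist (f x) (f x') \<le> M * dist x x' + M * K * ulog (dist p x')"
proof -
  have "dist (f x) (f x') \<le> M * dist x x' + M * K * ulog (dist p x')"
    if "dist x x' \<le> real n * ln 2" for n
    using that
  proof (induction n arbitrary: x)
    case (0 x)
    then have "x = x'" by simp
    moreover have "ulog (dist p x') \<le> K * ulog (dist p x')"
      using near[of x' x'] ulog_pos[of "dist p x'"] by simp
    ultimately show ?case
      using M ulog_pos[of "dist p x'"] by (simp add: mult.assoc)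
  next
    case (Suc n x)
    show ?case
    proof (cases "dist x x' \<le> ulog (dist p x)")
      case True
      have "dist (f x) (f x') \<le> M * ulog (dist p x)" by (rule step[OF True])
      also have "\<dots> \<le> M * (K * ulog (dist p x'))"
        using M near[OF True] by (intro mult_left_mono)
      also have "\<dots> \<le> M * dist x x' + M * K * ulog (dist p x')"
        using M by (simp add: mult.assoc)
      finally show ?thesis .
    next
      case False
      obtain z where z: "dist x z = ulog (dist p x)" "dist z x' = dist x x' - ulog (dist p x)"
        using geodesic_point[OF geo, of "ulog (dist p x)" x x'] False ulog_pos[of "dist p x"]
        by auto
      have "dist z x' \<le> real n * ln 2"
        using z(2) Suc.prems ulog_ge[of "dist p x"] by (simp add: algebra_simps)
      then have "dist (f z) (f x') \<le> M * dist z x' + M * K * ulog (dist p x')"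
        by (rule Suc.IH)
      moreover have "dist (f x) (f z) \<le> M * dist x z"
        using step[of x z] z(1) by simp
      moreover have "M * dist x x' = M * dist x z + M * dist z x'"
        using z by (simp flip: distrib_left)
      ultimately show ?thesis using dist_triangle[of "f x" "f x'" "f z"] by linarith
    qed
  qed
  moreover obtain n where "dist x x' / ln 2 \<le> real n" using real_arch_simple by blast
  then have "dist x x' \<le> real n * ln 2" by (simp add: field_simps)
  ultimately show ?thesis by blast
qed

lemma log_lipschitz_if_controlled:
  fixes p :: "'a::metric_space" and f :: "'a \<Rightarrow> 'b::metric_space"
  assumes geo: "geodesic_space TYPE('a)"
    and controlled: "\<And>E. E \<in> O_entourages ulog p \<Longrightarrow> map_prod f f ` E \<in> O_entourages ulog q"
  shows "log_lipschitz p f"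
proof -
  \<comment> \<open>The factor 2 makes this entourage contain the pairs at distance at most 1.\<close>
  define E where "E = {(x, x'). dist x x' \<le> 2 * ulog (dist p x)}"
  have "E \<in> O_entourages ulog p"
    unfolding O_entourages_ulog_iff E_def by (intro exI[of _ 2]) auto
  then have "map_prod f f ` E \<in> O_entourages ulog q" by (rule controlled)
  then obtain L where L: "L \<ge> 0"
    "\<And>y y'. (y, y') \<in> map_prod f f ` E \<Longrightarrow> dist y y' \<le> L * ulog (dist q y)"
    unfolding O_entourages_ulog_iff by blast
  have step: "dist (f x) (f x') \<le> L * ulog (dist q (f x))"
    if "dist x x' \<le> 2 * ulog (dist p x)" for x x'
    using that by (intro L(2)) (auto simp: E_def)
  have "dist (f x) (f x') \<le> L * ulog (dist q (f x))" if "dist x x' \<le> 1" for x x'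
    using that one_le_two_ulog[of "dist p x"] by (intro step) linarith
  then obtain A where A: "A \<ge> 0" "\<And>x. dist q (f x) \<le> A * (dist p x + 2)\<^sup>2"
    using quadratic_growth_if_controlled[OF geo L(1)] by metis
  obtain H where H: "H \<ge> 0"
    "\<And>r s. 0 \<le> r \<Longrightarrow> 0 \<le> s \<Longrightarrow> s \<le> A * (r + 2)\<^sup>2 \<Longrightarrow> ulog s \<le> H * ulog r"
    using ulog_quadratic_bound[OF A(1), of 2] by auto
  have "dist (f x) (f x') \<le> L * H * ulog (dist p x)" if "dist x x' \<le> ulog (dist p x)" for x x'
  proof -
    have "dist (f x) (f x') \<le> L * ulog (dist q (f x))"
      using that ulog_pos[of "dist p x"] by (intro step) linarith
    also have "\<dots> \<le> L * (H * ulog (dist p x))"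
      using L(1) A(2) H(2) by (intro mult_left_mono) auto
    finally show ?thesis by simp
  qed
  moreover obtain K where K: "K \<ge> 0" "\<And>(p::'a) x x'. dist x x' \<le> 1 * ulog (dist p x) \<Longrightarrow>
        ulog (dist p x) \<le> K * ulog (dist p x') \<and> ulog (dist p x') \<le> K * ulog (dist p x)"
    using ulog_near[of 1] by (metis zero_le_one)
  ultimately have lip: "dist (f x) (f x') \<le> L * H * dist x x' + L * H * K * ulog (dist p x')" for x x'
    using L(1) H(1) by (intro lipschitz_by_walking[OF geo]) auto
  have "dist (f x) (f x') \<le> L * H * (1 + K) * (dist x x' + ulog (dist p x) + ulog (dist p x'))"
    for x x'
  proof -
    have "L * H * dist x x' + L * H * K * ulog (dist p x')
        = L * H * (dist x x' + K * ulog (dist p x'))" by (simp add: algebra_simps)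
    also have "\<dots> \<le> L * H * ((1 + K) * (dist x x' + ulog (dist p x) + ulog (dist p x')))"
      using L(1) H(1) K(1) ulog_pos[of "dist p x"] ulog_pos[of "dist p x'"]
      by (intro mult_left_mono) (simp_all add: algebra_simps)
    finally show ?thesis using lip[of x x'] by (simp add: mult.assoc)
  qed
  then show ?thesis
    unfolding log_lipschitz_def using L(1) H(1) K(1)
    by (intro exI[of _ "L * H * (1 + K)"]) auto
qed

lemma coarse_equivalence_iff:
  fixes p :: "'a::metric_space" and q :: "'b::metric_space"
  assumes "geodesic_space TYPE('a)" and "geodesic_space TYPE('b)"
  shows "coarse_equivalence (O_entourages ulog p) (O_entourages ulog q) \<phi> \<longleftrightarrow>
         log_lipschitz_equivalence p q \<phi>"
proof
  assume "coarse_equivalence (O_entourages ulog p) (O_entourages ulog q) \<phi>"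
  then obtain \<psi> where
    "coarse_map (O_entourages ulog p) (O_entourages ulog q) \<phi>"
    "coarse_map (O_entourages ulog q) (O_entourages ulog p) \<psi>"
    "log_close_to_id p (\<psi> \<circ> \<phi>)" "log_close_to_id q (\<phi> \<circ> \<psi>)"
    unfolding coarse_equivalence_def log_close_to_id_iff_entourage by blast
  moreover from this have "log_lipschitz p \<phi>" "log_lipschitz q \<psi>"
    unfolding coarse_map_def
    using log_lipschitz_if_controlled[OF assms(1)] log_lipschitz_if_controlled[OF assms(2)]
    by blast+
  ultimately show "log_lipschitz_equivalence p q \<phi>"
    unfolding log_lipschitz_equivalence_def by blast
next
  assume "log_lipschitz_equivalence p q \<phi>"
  then obtain \<psi> where \<psi>: "log_lipschitz p \<phi>" "log_lipschitz q \<psi>"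
    "log_close_to_id p (\<psi> \<circ> \<phi>)" "log_close_to_id q (\<phi> \<circ> \<psi>)"
    unfolding log_lipschitz_equivalence_def by blast
  then have "coarse_map (O_entourages ulog p) (O_entourages ulog q) \<phi>"
    "coarse_map (O_entourages ulog q) (O_entourages ulog p) \<psi>"
    by (auto intro: coarse_map_if_log_lipschitz)
  with \<psi>(3,4) show "coarse_equivalence (O_entourages ulog p) (O_entourages ulog q) \<phi>"
    unfolding coarse_equivalence_def log_close_to_id_iff_entourage[symmetric] by blast
qed

theorem theoremA:
  fixes oX :: "'a::metric_space" and oY :: "'b::metric_space" and \<phi> :: "'a \<Rightarrow> 'b"
  assumes "geodesic_space TYPE('a)" and "geodesic_space TYPE('b)"
  shows "O_bilipschitz_equivalence ulog oX oY \<phi> \<longleftrightarrow>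
         coarse_equivalence (O_entourages ulog oX) (O_entourages ulog oY) \<phi>"
  unfolding O_bilipschitz_equivalence_iff coarse_equivalence_iff[OF assms] by (rule refl)

end
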